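(* Let $m,n\ge 1$ and let $A\in\mathbb{R}^{m\times m}$, $B\in\mathbb{R}^{m\times n}$, $C\in\mathbb{R}^{n\times m}$, $D\in\mathbb{R}^{n\times n}$. If the matrix $$K=\begin{bmatrix} D & -C\\ -B & A\end{bmatrix}$$ is a regular $M$-matrix, then the equation $XCX-XD-AX+B=0$ (with unknown $X\in\mathbb{R}^{m\times n}$) has a minimal nonnegative solution $\Phi$, and $D-C\Phi$ is a regular $M$-matrix.
   Context: For real matrices or vectors of the same size, $A\ge B$ ($A>B$) means $a_{ij}\ge b_{ij}$ ($a_{ij}>b_{ij}$) for all $i,j$; a matrix $X$ is nonnegative if $X\ge 0$. A real square matrix is a $Z$-matrix if all its off-diagonal entries are nonpositive; any $Z$-matrix can be written as $sI-N$ with $N\ge 0$. A $Z$-matrix $sI-N$ ($N\ge 0$) is an $M$-matrix if $s\ge\rho(N)$, where $\rho$ is the spectral radius; it is a singular $M$-matrix if $s=\rho(N)$ and a nonsingular $M$-matrix if $s>\rho(N)$. An $M$-matrix $A$ is regular if $Av\ge 0$ for some vector $v>0$. A minimal nonnegative solution of a matrix equation is a nonnegative solution $\Phi$ such that $\Phi\le X$ for every nonnegative solution $X$. *)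

theory Defs
  imports "Jordan_Normal_Form.Spectral_Radius"
begin

text \<open>The order \<open>\<le>\<close> on matrices and vectors is the entrywise one, including agreement of
  dimensions. The library's \<open><\<close> on vectors is \<open>\<le>\<close> without equality, so entrywise strict
  positivity is a separate notion.\<close>

definition nonneg_mat :: "real mat \<Rightarrow> bool" where
  "nonneg_mat X \<longleftrightarrow> 0\<^sub>m (dim_row X) (dim_col X) \<le> X"

definition pos_vec :: "real vec \<Rightarrow> bool" where
  "pos_vec v \<longleftrightarrow> (\<forall>i < dim_vec v. 0 < v $ i)"

definition Z_matrix :: "real mat \<Rightarrow> bool" where
  "Z_matrix A \<longleftrightarrow> square_mat A \<and>
     (\<forall>i < dim_row A. \<forall>j < dim_col A. i \<noteq> j \<longrightarrow> A $$ (i,j) \<le> 0)"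

text \<open>The condition \<open>\<rho>(N) \<le> s\<close> does not depend on the chosen splitting \<open>A = s I - N\<close>, since
  \<open>\<rho>(N + t I) = \<rho>(N) + t\<close> whenever \<open>N\<close> and \<open>N + t I\<close> are both nonnegative; so it is
  enough to ask for one splitting.\<close>

definition M_matrix :: "real mat \<Rightarrow> bool" where
  "M_matrix A \<longleftrightarrow> Z_matrix A \<and>
     (\<exists>s N. N \<in> carrier_mat (dim_row A) (dim_row A) \<and> nonneg_mat N \<and>
        A = s \<cdot>\<^sub>m 1\<^sub>m (dim_row A) - N \<and>
        spectral_radius (map_mat complex_of_real N) \<le> s)"

definition regular_M_matrix :: "real mat \<Rightarrow> bool" where
  "regular_M_matrix A \<longleftrightarrow> M_matrix A \<and>
     (\<exists>v \<in> carrier_vec (dim_row A). pos_vec v \<and> 0\<^sub>v (dim_row A) \<le> A *\<^sub>v v)"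

definition minimal_nonneg_solution ::
    "nat \<Rightarrow> nat \<Rightarrow> (real mat \<Rightarrow> bool) \<Rightarrow> real mat \<Rightarrow> bool" where
  "minimal_nonneg_solution m n E \<Phi> \<longleftrightarrow>
     \<Phi> \<in> carrier_mat m n \<and> nonneg_mat \<Phi> \<and> E \<Phi> \<and>
     (\<forall>X \<in> carrier_mat m n. nonneg_mat X \<longrightarrow> E X \<longrightarrow> \<Phi> \<le> X)"

end

theory Submission
  imports Defs
begin

text \<open>Split a positive vector \<open>v\<close> with \<open>K v \<ge> 0\<close> into blocks \<open>u\<close>, \<open>w\<close>, so that \<open>C w \<le> D u\<close> and
  \<open>B u \<le> A w\<close>; since \<open>K\<close> is a Z-matrix, \<open>B\<close> and \<open>C\<close> are nonnegative and \<open>A\<close> and \<open>D\<close> have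
  nonpositive off-diagonal entries. Moving the diagonals of \<open>A\<close> and \<open>D\<close> to the other side, the
  equation reads \<open>(a\<^sub>i\<^sub>i + d\<^sub>j\<^sub>j) x\<^sub>i\<^sub>j = F(X)\<^sub>i\<^sub>j\<close> with \<open>F\<close> monotone on nonnegative matrices.
  Iterating from \<open>X = 0\<close> gives an increasing sequence that stays below every nonnegative
  solution (\<open>iter_le_solution\<close>). It also keeps the invariant \<open>X u \<le> w\<close> (\<open>iter_mult_le\<close>), which
  bounds it because \<open>u > 0\<close>. Hence it converges to the minimal nonnegative solution \<open>\<Phi>\<close>, and
  \<open>\<Phi> u \<le> w\<close>.

  In the singular case some diagonal entries may be zero. If \<open>a\<^sub>i\<^sub>i = 0\<close>, then row \<open>i\<close> of both \<open>A\<close>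
  and \<open>B\<close> vanishes (\<open>zero_row\<close>), so row \<open>i\<close> of the iterates may be kept at zero, where the
  equation holds trivially; this covers all entries with \<open>a\<^sub>i\<^sub>i + d\<^sub>j\<^sub>j = 0\<close>.

  Finally \<open>D - C \<Phi>\<close> is a Z-matrix with \<open>(D - C \<Phi>) u \<ge> D u - C w \<ge> 0\<close>, and a Z-matrix that sends
  some positive vector to a nonnegative one is a regular M-matrix (\<open>regular_M_matrixI\<close>).\<close>

section \<open>M-matrices from a nonnegative image of a positive vector\<close>

lemma spectral_radius_le_of_mult_le:
  fixes N :: "real mat" and v :: "real vec"
  assumes N: "N \<in> carrier_mat n n" and n: "n \<ge> 1"
    and N_nonneg: "\<And>i j. i < n \<Longrightarrow> j < n \<Longrightarrow> 0 \<le> N $$ (i,j)"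
    and v_pos: "\<And>i. i < n \<Longrightarrow> 0 < v $ i"
    and le: "\<And>i. i < n \<Longrightarrow> (\<Sum>j<n. N $$ (i,j) * v $ j) \<le> s * v $ i"
  shows "spectral_radius (map_mat complex_of_real N) \<le> s"
proof -
  let ?M = "map_mat complex_of_real N"
  have M: "?M \<in> carrier_mat n n" using N by simp
  have "spectral_radius ?M \<in> norm ` spectrum ?M"
    using spectral_radius_mem_max(1)[OF M] n by auto
  then obtain l where sr: "spectral_radius ?M = norm l" and "eigenvalue ?M l"
    by (auto simp: spectrum_def)
  then obtain x where x: "x \<in> carrier_vec n" and x0: "x \<noteq> 0\<^sub>v n" and eq: "?M *\<^sub>v x = l \<cdot>\<^sub>v x"
    using M by (auto simp: eigenvalue_def eigenvector_def)
  \<comment> \<open>Compare moduli at an index where the quotient of \<open>|x|\<close> by \<open>v\<close> is largest.\<close>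
  define q where "q i = norm (x $ i) / v $ i" for i
  define t where "t = Max (q ` {..<n})"
  have ne: "q ` {..<n} \<noteq> {}" using n by (auto simp: lessThan_empty_iff bot_nat_def)
  have "t \<in> q ` {..<n}" unfolding t_def using ne by (intro Max_in) auto
  then obtain i where i: "i < n" and ti: "t = q i" by auto
  have q_le: "q j \<le> t" if "j < n" for j unfolding t_def using that by (intro Max_ge) auto
  have x_le: "norm (x $ j) \<le> t * v $ j" if "j < n" for j
    using q_le[OF that] v_pos[OF that] by (simp add: q_def field_simps)
  have x_i: "norm (x $ i) = t * v $ i" using v_pos[OF i] by (simp add: ti q_def)
  obtain j where j: "j < n" "x $ j \<noteq> 0"
    using x x0 by (metis carrier_vecD eq_vecI index_zero_vec)
  have "0 < q j" using j v_pos[of j] by (simp add: q_def)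
  then have t_pos: "0 < t" using q_le[OF j(1)] by linarith
  have "(\<Sum>j<n. complex_of_real (N $$ (i,j)) * x $ j) = (?M *\<^sub>v x) $ i"
    using i N x by (auto simp: scalar_prod_def atLeast0LessThan intro!: sum.cong)
  also have "\<dots> = l * x $ i" using eq i x by simp
  finally have "norm l * norm (x $ i) = norm (\<Sum>j<n. complex_of_real (N $$ (i,j)) * x $ j)"
    by (simp add: norm_mult)
  also have "\<dots> \<le> (\<Sum>j<n. N $$ (i,j) * norm (x $ j))"
    by (rule order_trans[OF norm_sum], rule sum_mono)
       (use N_nonneg i in \<open>simp add: norm_mult\<close>)
  also have "\<dots> \<le> (\<Sum>j<n. N $$ (i,j) * (t * v $ j))"
    by (intro sum_mono mult_left_mono x_le N_nonneg) (use i in auto)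
  also have "\<dots> = t * (\<Sum>j<n. N $$ (i,j) * v $ j)"
    by (simp add: sum_distrib_left mult.left_commute)
  also have "\<dots> \<le> t * (s * v $ i)" using le[OF i] t_pos by simp
  finally have "norm l * (t * v $ i) \<le> s * (t * v $ i)" by (simp add: x_i mult_ac)
  moreover have "0 < t * v $ i" using t_pos v_pos[OF i] by simp
  ultimately show ?thesis unfolding sr by (rule mult_right_le_imp_le)
qed

text \<open>For a Z-matrix, the vector condition of regularity alone already gives the spectral bound.\<close>

lemma regular_M_matrixI:
  fixes R :: "real mat" and v :: "real vec"
  assumes R: "R \<in> carrier_mat n n" and n: "n \<ge> 1"
    and off: "\<And>i j. i < n \<Longrightarrow> j < n \<Longrightarrow> i \<noteq> j \<Longrightarrow> R $$ (i,j) \<le> 0"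
    and v: "v \<in> carrier_vec n" and v_pos: "\<And>i. i < n \<Longrightarrow> 0 < v $ i"
    and Rv: "\<And>i. i < n \<Longrightarrow> 0 \<le> (\<Sum>j<n. R $$ (i,j) * v $ j)"
  shows "regular_M_matrix R"
proof -
  \<comment> \<open>Any bound of the diagonal entries makes \<open>s I - R\<close> nonnegative.\<close>
  define s where "s = Max ((\<lambda>i. R $$ (i,i)) ` {..<n})"
  have s: "R $$ (i,i) \<le> s" if "i < n" for i unfolding s_def using that by (intro Max_ge) auto
  define N where "N = s \<cdot>\<^sub>m 1\<^sub>m n - R"
  have N: "N \<in> carrier_mat n n" using R by (simp add: N_def minus_carrier_mat)
  have N_idx: "N $$ (i,j) = (if i = j then s else 0) - R $$ (i,j)" if "i < n" "j < n" for i j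
    using that R by (simp add: N_def)
  have N_nonneg: "0 \<le> N $$ (i,j)" if "i < n" "j < n" for i j
    using s off that by (simp add: N_idx)
  have "spectral_radius (map_mat complex_of_real N) \<le> s"
  proof (rule spectral_radius_le_of_mult_le[OF N n N_nonneg v_pos])
    fix i assume i: "i < n"
    have "(\<Sum>j<n. N $$ (i,j) * v $ j)
        = (\<Sum>j<n. (if i = j then s * v $ j else 0) - R $$ (i,j) * v $ j)"
      using i by (intro sum.cong) (auto simp: N_idx algebra_simps)
    also have "\<dots> = s * v $ i - (\<Sum>j<n. R $$ (i,j) * v $ j)"
      using i by (simp add: sum_subtractf)
    finally show "(\<Sum>j<n. N $$ (i,j) * v $ j) \<le> s * v $ i" using Rv[OF i] by simp
  qed
  moreover have "R = s \<cdot>\<^sub>m 1\<^sub>m n - N"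
    by (rule eq_matI) (use R N in \<open>auto simp: N_idx\<close>)
  moreover have "nonneg_mat N"
    using N N_nonneg by (auto simp: nonneg_mat_def less_eq_mat_def)
  moreover have "Z_matrix R" using R off by (auto simp: Z_matrix_def)
  moreover have "0\<^sub>v n \<le> R *\<^sub>v v"
    using R v Rv by (auto simp: less_eq_vec_def scalar_prod_def atLeast0LessThan)
  moreover have "pos_vec v" using v v_pos by (auto simp: pos_vec_def)
  ultimately show ?thesis
    using R N v by (auto simp: regular_M_matrix_def M_matrix_def)
qed

section \<open>The entrywise fixed-point iteration\<close>

lemma sum_mult_assoc:
  fixes f :: "'k \<Rightarrow> real"
  shows "(\<Sum>j\<in>J. (\<Sum>k\<in>K. f k * g k j) * u j) = (\<Sum>k\<in>K. f k * (\<Sum>j\<in>J. g k j * u j))"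
  unfolding sum_distrib_left sum_distrib_right
  by (subst sum.swap) (simp add: mult.assoc)

text \<open>The data of the Riccati equation as functions of row and column indices, where \<open>a\<close>, \<open>b\<close>,
  \<open>c\<close>, \<open>d\<close> hold the entries of \<open>A\<close>, \<open>B\<close>, \<open>C\<close>, \<open>D\<close>. The signs say that
  \<open>K = [D, - C; - B, A]\<close> is a Z-matrix, and \<open>top\<close> and \<open>bot\<close> that it sends the positive vector
  with blocks \<open>u\<close> and \<open>w\<close> to a nonnegative one.\<close>

locale regular_riccati =
  fixes m n :: nat and a b c d :: "nat \<Rightarrow> nat \<Rightarrow> real" and u w :: "nat \<Rightarrow> real"
  assumes b_nonneg: "\<And>i j. i < m \<Longrightarrow> j < n \<Longrightarrow> 0 \<le> b i j"
    and c_nonneg: "\<And>k l. k < n \<Longrightarrow> l < m \<Longrightarrow> 0 \<le> c k l"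
    and a_off: "\<And>i l. i < m \<Longrightarrow> l < m \<Longrightarrow> i \<noteq> l \<Longrightarrow> a i l \<le> 0"
    and d_off: "\<And>k j. k < n \<Longrightarrow> j < n \<Longrightarrow> k \<noteq> j \<Longrightarrow> d k j \<le> 0"
    and u_pos: "\<And>j. j < n \<Longrightarrow> 0 < u j"
    and w_pos: "\<And>i. i < m \<Longrightarrow> 0 < w i"
    and top: "\<And>k. k < n \<Longrightarrow> (\<Sum>l<m. c k l * w l) \<le> (\<Sum>j<n. d k j * u j)"
    and bot: "\<And>i. i < m \<Longrightarrow> (\<Sum>j<n. b i j * u j) \<le> (\<Sum>l<m. a i l * w l)"
begin

text \<open>The entries of \<open>X C X - X D - A X + B\<close>.\<close>

definition res :: "(nat \<Rightarrow> nat \<Rightarrow> real) \<Rightarrow> nat \<Rightarrow> nat \<Rightarrow> real" where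
  "res X i j = (\<Sum>k<n. X i k * (\<Sum>l<m. c k l * X l j)) - (\<Sum>k<n. X i k * d k j)
     - (\<Sum>l<m. a i l * X l j) + b i j"

text \<open>The residual with the diagonal parts of \<open>A\<close> and \<open>D\<close> moved to the other side of the
  equation: an expression in \<open>X\<close> with nonnegative coefficients.\<close>

definition rhs :: "(nat \<Rightarrow> nat \<Rightarrow> real) \<Rightarrow> nat \<Rightarrow> nat \<Rightarrow> real" where
  "rhs X i j = res X i j + (a i i + d j j) * X i j"

text \<open>The Jacobi-type iteration from zero. If the diagonal sum \<open>a i i + d j j\<close> vanishes, division
  by zero yields \<open>0\<close>, and the entry stays \<open>0\<close> throughout.\<close>

primrec iter :: "nat \<Rightarrow> nat \<Rightarrow> nat \<Rightarrow> real" where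
  "iter 0 = (\<lambda>i j. 0)"
| "iter (Suc k) = (\<lambda>i j. rhs (iter k) i j / (a i i + d j j))"

lemma rhs_split:
  assumes i: "i < m" and j: "j < n"
  shows "rhs X i j = (\<Sum>k<n. X i k * (\<Sum>l<m. c k l * X l j))
    + (\<Sum>k\<in>{..<n}-{j}. X i k * - d k j) + (\<Sum>l\<in>{..<m}-{i}. - a i l * X l j) + b i j"
proof -
  have "(\<Sum>k<n. X i k * d k j) = X i j * d j j + (\<Sum>k\<in>{..<n}-{j}. X i k * d k j)"
    using j by (intro sum.remove) auto
  moreover have "(\<Sum>l<m. a i l * X l j) = a i i * X i j + (\<Sum>l\<in>{..<m}-{i}. a i l * X l j)"
    using i by (intro sum.remove) auto
  ultimately show ?thesis by (simp add: rhs_def res_def sum_negf algebra_simps)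
qed

lemma rhs_mono:
  assumes i: "i < m" and j: "j < n"
    and X_nonneg: "\<And>i j. i < m \<Longrightarrow> j < n \<Longrightarrow> 0 \<le> X i j"
    and XY: "\<And>i j. i < m \<Longrightarrow> j < n \<Longrightarrow> X i j \<le> Y i j"
  shows "rhs X i j \<le> rhs Y i j"
proof -
  have Y_nonneg: "0 \<le> Y i j" if "i < m" "j < n" for i j
    using X_nonneg[OF that] XY[OF that] by linarith
  have "(\<Sum>k<n. X i k * (\<Sum>l<m. c k l * X l j)) \<le> (\<Sum>k<n. Y i k * (\<Sum>l<m. c k l * Y l j))"
  proof (rule sum_mono, rule mult_mono)
    fix k assume "k \<in> {..<n}"
    then have k: "k < n" by simp
    show "X i k \<le> Y i k" "0 \<le> Y i k" using XY Y_nonneg i k by auto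
    show "(\<Sum>l<m. c k l * X l j) \<le> (\<Sum>l<m. c k l * Y l j)"
      using k j c_nonneg XY by (intro sum_mono mult_left_mono) auto
    show "0 \<le> (\<Sum>l<m. c k l * X l j)"
      using k j c_nonneg X_nonneg by (intro sum_nonneg mult_nonneg_nonneg) auto
  qed
  moreover have "(\<Sum>k\<in>{..<n}-{j}. X i k * - d k j) \<le> (\<Sum>k\<in>{..<n}-{j}. Y i k * - d k j)"
    using i j XY d_off by (intro sum_mono mult_right_mono) auto
  moreover have "(\<Sum>l\<in>{..<m}-{i}. - a i l * X l j) \<le> (\<Sum>l\<in>{..<m}-{i}. - a i l * Y l j)"
    using i j XY a_off by (intro sum_mono mult_left_mono) auto
  ultimately show ?thesis unfolding rhs_split[OF i j] by linarith
qed

lemma rhs_nonneg: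
  assumes "i < m" "j < n" and "\<And>i j. i < m \<Longrightarrow> j < n \<Longrightarrow> 0 \<le> X i j"
  shows "0 \<le> rhs X i j"
proof -
  have "rhs (\<lambda>i j. 0) i j \<le> rhs X i j" using assms by (intro rhs_mono) auto
  then show ?thesis using b_nonneg[OF assms(1,2)] by (simp add: rhs_def res_def)
qed

lemma a_diag:
  assumes i: "i < m"
  shows "(\<Sum>j<n. b i j * u j) + (\<Sum>l\<in>{..<m}-{i}. - a i l * w l) \<le> a i i * w i"
  using bot[OF i] i by (simp add: sum.remove[of "{..<m}" i "\<lambda>l. a i l * w l"] sum_negf)

lemma off_diag_nonneg:
  assumes i: "i < m"
  shows "0 \<le> (\<Sum>l\<in>{..<m}-{i}. - a i l * w l)" "0 \<le> (\<Sum>j<n. b i j * u j)"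
proof -
  show "0 \<le> (\<Sum>l\<in>{..<m}-{i}. - a i l * w l)"
    by (intro sum_nonneg mult_nonneg_nonneg) (use i a_off w_pos in \<open>auto intro: less_imp_le\<close>)
  show "0 \<le> (\<Sum>j<n. b i j * u j)"
    by (intro sum_nonneg mult_nonneg_nonneg) (use i b_nonneg u_pos in \<open>auto intro: less_imp_le\<close>)
qed

lemma a_diag_nonneg: "i < m \<Longrightarrow> 0 \<le> a i i"
  using a_diag[of i] off_diag_nonneg[of i] w_pos[of i]
  by (metis add_nonneg_nonneg mult_le_cancel_right_pos mult_zero_left order_trans)

lemma d_diag_nonneg:
  assumes k: "k < n"
  shows "0 \<le> d k k"
proof -
  have "0 \<le> (\<Sum>l<m. c k l * w l)"
    using k c_nonneg w_pos by (force intro!: sum_nonneg mult_nonneg_nonneg intro: less_imp_le)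
  also have "\<dots> \<le> (\<Sum>j<n. d k j * u j)" by (rule top[OF k])
  also have "\<dots> = d k k * u k + (\<Sum>j\<in>{..<n}-{k}. d k j * u j)"
    using k by (intro sum.remove) auto
  also have "(\<Sum>j\<in>{..<n}-{k}. d k j * u j) \<le> 0"
    using k d_off u_pos by (intro sum_nonpos mult_nonpos_nonneg) (auto intro: less_imp_le)
  finally show ?thesis using u_pos[OF k] by (simp add: zero_le_mult_iff)
qed

text \<open>A vanishing diagonal entry of \<open>A\<close> forces the whole row of \<open>[- B, A]\<close> to vanish, since that
  row sends a positive vector to a nonnegative number.\<close>

lemma zero_row:
  assumes i: "i < m" and a0: "a i i = 0"
  shows "l < m \<Longrightarrow> a i l = 0" and "j < n \<Longrightarrow> b i j = 0"
proof -
  have sums: "(\<Sum>l\<in>{..<m}-{i}. - a i l * w l) = 0" "(\<Sum>j<n. b i j * u j) = 0"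
    using a_diag[OF i] off_diag_nonneg[OF i] a0 by auto
  show "a i l = 0" if l: "l < m"
  proof (cases "l = i")
    case False
    have "\<forall>l\<in>{..<m}-{i}. - a i l * w l = 0"
      using sums(1) a_off[OF i] w_pos
      by (subst (asm) sum_nonneg_eq_0_iff) (auto intro!: mult_nonneg_nonneg intro: less_imp_le simp del: mult_minus_left)
    then show ?thesis using l False w_pos[OF l] by force
  qed (use a0 in simp)
  show "b i j = 0" if j: "j < n"
  proof -
    have "\<forall>j\<in>{..<n}. b i j * u j = 0"
      using sums(2) b_nonneg[OF i] u_pos
      by (subst (asm) sum_nonneg_eq_0_iff) (auto intro!: mult_nonneg_nonneg intro: less_imp_le)
    then show ?thesis using j u_pos[OF j] by force
  qed
qed

lemma res_zero_row:
  assumes "i < m" "j < n" "a i i = 0" and "\<And>k. k < n \<Longrightarrow> X i k = 0"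
  shows "res X i j = 0"
  using assms zero_row by (simp add: res_def)

lemma iter_zero_row:
  assumes "i < m" "a i i = 0"
  shows "j < n \<Longrightarrow> iter k i j = 0"
proof (induction k arbitrary: j)
  case (Suc k)
  then show ?case using assms res_zero_row[of i j "iter k"] by (simp add: rhs_def)
qed simp

lemma iter_nonneg: "i < m \<Longrightarrow> j < n \<Longrightarrow> 0 \<le> iter k i j"
proof (induction k arbitrary: i j)
  case (Suc k)
  then show ?case by (simp add: rhs_nonneg a_diag_nonneg d_diag_nonneg)
qed simp

lemma iter_mono: "i < m \<Longrightarrow> j < n \<Longrightarrow> iter k i j \<le> iter (Suc k) i j"
proof (induction k arbitrary: i j)
  case 0
  then show ?case using iter_nonneg[of i j "Suc 0"] by simp
next
  case (Suc k)
  have "rhs (iter k) i j \<le> rhs (iter (Suc k)) i j"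
    using Suc by (intro rhs_mono iter_nonneg) auto
  then show ?case
    using Suc.prems by (simp add: divide_right_mono a_diag_nonneg d_diag_nonneg)
qed

text \<open>This also holds where the diagonal sum vanishes: both sides are then zero.\<close>

lemma iter_step:
  assumes i: "i < m" and j: "j < n"
  shows "(a i i + d j j) * (iter (Suc k) i j - iter k i j) = res (iter k) i j"
proof (cases "a i i + d j j = 0")
  case True
  then have "a i i = 0" using a_diag_nonneg[OF i] d_diag_nonneg[OF j] by linarith
  then show ?thesis using True res_zero_row[OF i j _ iter_zero_row] i by simp
next
  case False
  then show ?thesis by (simp add: rhs_def field_simps)
qed

lemma res_iter_nonneg:
  assumes "i < m" "j < n"
  shows "0 \<le> res (iter k) i j"
  unfolding iter_step[OF assms, symmetric]
  by (intro mult_nonneg_nonneg) (use assms a_diag_nonneg d_diag_nonneg iter_mono in auto)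

text \<open>Multiplying the residual by \<open>u\<close>: this is where the invariant \<open>X u \<le> w\<close> meets
  \<open>C w \<le> D u\<close> and \<open>B u \<le> A w\<close>.\<close>

lemma res_mult_le:
  assumes i: "i < m"
    and X_nonneg: "\<And>i j. i < m \<Longrightarrow> j < n \<Longrightarrow> 0 \<le> X i j"
    and Xu: "\<And>i. i < m \<Longrightarrow> (\<Sum>j<n. X i j * u j) \<le> w i"
  shows "(\<Sum>j<n. res X i j * u j) \<le> a i i * (w i - (\<Sum>j<n. X i j * u j))"
proof -
  define y where "y l = (\<Sum>j<n. X l j * u j)" for l
  have y_le: "y l \<le> w l" if "l < m" for l using Xu[OF that] by (simp add: y_def)
  have 1: "(\<Sum>j<n. (\<Sum>k<n. X i k * (\<Sum>l<m. c k l * X l j)) * u j)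
      = (\<Sum>k<n. X i k * (\<Sum>l<m. c k l * y l))"
    by (simp add: y_def sum_mult_assoc)
  have 2: "(\<Sum>j<n. (\<Sum>k<n. X i k * d k j) * u j) = (\<Sum>k<n. X i k * (\<Sum>j<n. d k j * u j))"
    by (rule sum_mult_assoc)
  have 3: "(\<Sum>j<n. (\<Sum>l<m. a i l * X l j) * u j) = (\<Sum>l<m. a i l * y l)"
    by (simp add: y_def sum_mult_assoc)
  have "(\<Sum>j<n. res X i j * u j)
      = (\<Sum>k<n. X i k * (\<Sum>l<m. c k l * y l)) - (\<Sum>k<n. X i k * (\<Sum>j<n. d k j * u j))
        - (\<Sum>l<m. a i l * y l) + (\<Sum>j<n. b i j * u j)"
    by (simp add: res_def distrib_right left_diff_distrib sum.distrib sum_subtractf 1 2 3)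
  also have "(\<Sum>k<n. X i k * (\<Sum>l<m. c k l * y l)) \<le> (\<Sum>k<n. X i k * (\<Sum>j<n. d k j * u j))"
  proof (intro sum_mono mult_left_mono)
    fix k assume k: "k \<in> {..<n}"
    have "(\<Sum>l<m. c k l * y l) \<le> (\<Sum>l<m. c k l * w l)"
      using k c_nonneg y_le by (intro sum_mono mult_left_mono) auto
    then show "(\<Sum>l<m. c k l * y l) \<le> (\<Sum>j<n. d k j * u j)" using top k by force
  qed (use i X_nonneg in auto)
  also have "(\<Sum>k<n. X i k * (\<Sum>j<n. d k j * u j)) - (\<Sum>k<n. X i k * (\<Sum>j<n. d k j * u j))
        - (\<Sum>l<m. a i l * y l) + (\<Sum>j<n. b i j * u j)
      \<le> (\<Sum>l<m. a i l * (w l - y l))"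
    using bot[OF i] by (simp add: algebra_simps sum_subtractf)
  also have "\<dots> = a i i * (w i - y i) + (\<Sum>l\<in>{..<m}-{i}. a i l * (w l - y l))"
    using i by (intro sum.remove) auto
  also have "(\<Sum>l\<in>{..<m}-{i}. a i l * (w l - y l)) \<le> 0"
    using i a_off y_le by (intro sum_nonpos mult_nonpos_nonneg) auto
  finally show ?thesis by (simp add: y_def)
qed

text \<open>By monotonicity of the iteration, \<open>a i i\<close> times the \<open>i\<close>-th entry of the increment of \<open>X u\<close>
  is at most the \<open>i\<close>-th entry of the residual times \<open>u\<close>, so one step cannot pass \<open>w\<close>.\<close>

lemma iter_mult_le: "i < m \<Longrightarrow> (\<Sum>j<n. iter k i j * u j) \<le> w i"
proof (induction k arbitrary: i)
  case 0
  then show ?case using w_pos[of i] by simp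
next
  case (Suc k)
  note i = \<open>i < m\<close>
  show ?case
  proof (cases "a i i = 0")
    case True
    then have "(\<Sum>j<n. iter (Suc k) i j * u j) = 0"
      using iter_zero_row[OF i True] by (intro sum.neutral) (auto simp del: iter.simps)
    then show ?thesis using w_pos[OF i] by linarith
  next
    case False
    then have a_pos: "0 < a i i" using a_diag_nonneg[OF i] by linarith
    have "a i i * (\<Sum>j<n. (iter (Suc k) i j - iter k i j) * u j) \<le> (\<Sum>j<n. res (iter k) i j * u j)"
      unfolding sum_distrib_left
    proof (rule sum_mono)
      fix j assume "j \<in> {..<n}"
      then have j: "j < n" by simp
      have "a i i * (iter (Suc k) i j - iter k i j)
          \<le> (a i i + d j j) * (iter (Suc k) i j - iter k i j)"
        using d_diag_nonneg[OF j] iter_mono[OF i j, of k] by (intro mult_right_mono) auto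
      also have "\<dots> = res (iter k) i j" by (rule iter_step[OF i j])
      finally show "a i i * ((iter (Suc k) i j - iter k i j) * u j) \<le> res (iter k) i j * u j"
        using u_pos[OF j] by (simp add: mult.assoc[symmetric] del: iter.simps)
    qed
    also have "\<dots> \<le> a i i * (w i - (\<Sum>j<n. iter k i j * u j))"
      using Suc.IH by (intro res_mult_le[OF i] iter_nonneg) auto
    finally show ?thesis
      using a_pos by (simp add: left_diff_distrib sum_subtractf del: iter.simps)
  qed
qed

lemma iter_le_solution:
  assumes X_nonneg: "\<And>i j. i < m \<Longrightarrow> j < n \<Longrightarrow> 0 \<le> X i j"
    and X_sol: "\<And>i j. i < m \<Longrightarrow> j < n \<Longrightarrow> res X i j = 0"
  shows "i < m \<Longrightarrow> j < n \<Longrightarrow> iter k i j \<le> X i j"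
proof (induction k arbitrary: i j)
  case 0
  then show ?case by (simp add: X_nonneg)
next
  case (Suc k)
  have "rhs (iter k) i j \<le> rhs X i j"
    using Suc by (intro rhs_mono iter_nonneg) auto
  also have "\<dots> = (a i i + d j j) * X i j" using X_sol Suc.prems by (simp add: rhs_def)
  finally have le: "rhs (iter k) i j \<le> (a i i + d j j) * X i j" .
  show ?case
  proof (cases "a i i + d j j = 0")
    case True
    then show ?thesis using X_nonneg Suc.prems by simp
  next
    case False
    then have "0 < a i i + d j j"
      using a_diag_nonneg[of i] d_diag_nonneg[of j] Suc.prems by linarith
    then show ?thesis using le by (simp add: field_simps)
  qed
qed

text \<open>The entrywise limit of the iteration, the minimal nonnegative solution. It exists on the index
  range \<open>i < m\<close>, \<open>j < n\<close>; elsewhere the value is irrelevant.\<close>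

definition Phi :: "nat \<Rightarrow> nat \<Rightarrow> real" where
  "Phi i j = lim (\<lambda>k. iter k i j)"

lemma iter_tendsto:
  assumes i: "i < m" and j: "j < n"
  shows "(\<lambda>k. iter k i j) \<longlonglongrightarrow> Phi i j"
proof -
  have "iter k i j \<le> w i / u j" for k
  proof -
    have "iter k i j * u j \<le> (\<Sum>j<n. iter k i j * u j)"
      using i j iter_nonneg u_pos
      by (intro member_le_sum) (auto intro!: mult_nonneg_nonneg intro: less_imp_le)
    also have "\<dots> \<le> w i" by (rule iter_mult_le[OF i])
    finally show ?thesis using u_pos[OF j] by (simp add: field_simps)
  qed
  moreover have "incseq (\<lambda>k. iter k i j)" using iter_mono[OF i j] by (rule incseq_SucI)
  ultimately have "convergent (\<lambda>k. iter k i j)"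
    by (meson incseq_convergent convergentI)
  then show ?thesis unfolding Phi_def by (rule convergent_LIMSEQ_iff[THEN iffD1])
qed

lemma Phi_nonneg: "i < m \<Longrightarrow> j < n \<Longrightarrow> 0 \<le> Phi i j"
  by (rule LIMSEQ_le_const[OF iter_tendsto]) (auto intro: iter_nonneg)

lemma Phi_le_solution:
  assumes "i < m" "j < n"
    and "\<And>i j. i < m \<Longrightarrow> j < n \<Longrightarrow> 0 \<le> X i j"
    and "\<And>i j. i < m \<Longrightarrow> j < n \<Longrightarrow> res X i j = 0"
  shows "Phi i j \<le> X i j"
  by (rule LIMSEQ_le_const2[OF iter_tendsto]) (use assms iter_le_solution in auto)

lemma Phi_mult_le:
  assumes i: "i < m"
  shows "(\<Sum>j<n. Phi i j * u j) \<le> w i"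
proof (rule LIMSEQ_le_const2)
  show "(\<lambda>k. \<Sum>j<n. iter k i j * u j) \<longlonglongrightarrow> (\<Sum>j<n. Phi i j * u j)"
    by (intro tendsto_intros iter_tendsto) (use i in auto)
qed (use iter_mult_le[OF i] in auto)

lemma res_Phi:
  assumes i: "i < m" and j: "j < n"
  shows "res Phi i j = 0"
proof (rule LIMSEQ_unique)
  show "(\<lambda>k. res (iter k) i j) \<longlonglongrightarrow> res Phi i j"
    unfolding res_def by (intro tendsto_intros iter_tendsto) (use i j in auto)
  have "(\<lambda>k. (a i i + d j j) * (iter (Suc k) i j - iter k i j))
      \<longlonglongrightarrow> (a i i + d j j) * (Phi i j - Phi i j)"
    by (intro tendsto_intros iter_tendsto[THEN LIMSEQ_Suc] iter_tendsto) (use i j in auto)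
  then show "(\<lambda>k. res (iter k) i j) \<longlonglongrightarrow> 0"
    using iter_step[OF i j] by (simp del: iter.simps)
qed

end

section \<open>The minimal nonnegative solution\<close>

theorem theorem2:
  fixes A B C D :: "real mat" and m n :: nat
  assumes "m \<ge> 1" and "n \<ge> 1"
    and "A \<in> carrier_mat m m" and "B \<in> carrier_mat m n"
    and "C \<in> carrier_mat n m" and "D \<in> carrier_mat n n"
    and "regular_M_matrix (four_block_mat D (- C) (- B) A)"
  shows "\<exists>\<Phi>. minimal_nonneg_solution m n
            (\<lambda>X. X * C * X - X * D - A * X + B = 0\<^sub>m m n) \<Phi> \<and>
          regular_M_matrix (D - C * \<Phi>)"
proof -
  let ?K = "four_block_mat D (- C) (- B) A"
  note car = assms(3-6)
  have dimK: "dim_row ?K = n + m" "dim_col ?K = n + m" using car by auto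
  obtain v where v: "v \<in> carrier_vec (n + m)" and v_pos: "pos_vec v"
    and Kv: "0\<^sub>v (n + m) \<le> ?K *\<^sub>v v"
    using assms(7) unfolding regular_M_matrix_def dimK by blast
  have Z: "?K $$ (i,j) \<le> 0" if "i < n + m" "j < n + m" "i \<noteq> j" for i j
    using assms(7) that dimK unfolding regular_M_matrix_def M_matrix_def Z_matrix_def by metis
  define u where "u j = v $ j" for j
  define w where "w i = v $ (n + i)" for i
  define a where "a i j = A $$ (i,j)" for i j
  define b where "b i j = B $$ (i,j)" for i j
  define c where "c i j = C $$ (i,j)" for i j
  define d where "d i j = D $$ (i,j)" for i j
  have idx: "?K $$ (k,j) = d k j" "?K $$ (k,n+l) = - c k l"
    "?K $$ (n+i,j) = - b i j" "?K $$ (n+i,n+l) = a i l"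
    if "k < n" "j < n" "i < m" "l < m" for k j i l
    using that car by (auto simp: a_def b_def c_def d_def)
  have split: "(\<Sum>j<n+m. f j) = (\<Sum>j<n. f j) + (\<Sum>l<m. f (n + l))" for f :: "nat \<Rightarrow> real"
    by (induction m) (auto simp: algebra_simps)
  have Kv_sum: "0 \<le> (\<Sum>j<n. ?K $$ (k,j) * u j) + (\<Sum>l<m. ?K $$ (k,n+l) * w l)"
    if k: "k < n + m" for k
  proof -
    have "0 \<le> (?K *\<^sub>v v) $ k" using Kv k by (auto simp: less_eq_vec_def)
    also have "(?K *\<^sub>v v) $ k = (\<Sum>j<n+m. ?K $$ (k,j) * v $ j)"
      using k v dimK by (auto simp: scalar_prod_def atLeast0LessThan intro!: sum.cong
          simp del: index_mat_four_block)
    finally show ?thesis unfolding split u_def w_def .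
  qed
  interpret regular_riccati m n a b c d u w
  proof
    show "0 \<le> b i j" if "i < m" "j < n" for i j
      using Z[of "n+i" j] idx(3)[of 0 j i 0] that by (auto simp del: index_mat_four_block)
    show "0 \<le> c k l" if "k < n" "l < m" for k l
      using Z[of k "n+l"] idx(2)[of k 0 0 l] that by (auto simp del: index_mat_four_block)
    show "a i l \<le> 0" if "i < m" "l < m" "i \<noteq> l" for i l
      using Z[of "n+i" "n+l"] idx(4)[of 0 0 i l] that assms(2)
      by (auto simp del: index_mat_four_block)
    show "d k j \<le> 0" if "k < n" "j < n" "k \<noteq> j" for k j
      using Z[of k j] idx(1)[of k j 0 0] that assms(1) by (auto simp del: index_mat_four_block)
    show "0 < u j" if "j < n" for j using v_pos v that by (auto simp: pos_vec_def u_def)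
    show "0 < w i" if "i < m" for i using v_pos v that by (auto simp: pos_vec_def w_def)
    show "(\<Sum>l<m. c k l * w l) \<le> (\<Sum>j<n. d k j * u j)" if k: "k < n" for k
    proof -
      have "(\<Sum>j<n. ?K $$ (k,j) * u j) = (\<Sum>j<n. d k j * u j)"
        using idx(1)[of k _ 0 0] k assms(1) by (intro sum.cong) auto
      moreover have "(\<Sum>l<m. ?K $$ (k,n+l) * w l) = (\<Sum>l<m. - c k l * w l)"
        using idx(2)[of k 0 0] k assms(1) by (intro sum.cong) auto
      ultimately show ?thesis using Kv_sum[of k] k by (simp add: sum_negf)
    qed
    show "(\<Sum>j<n. b i j * u j) \<le> (\<Sum>l<m. a i l * w l)" if i: "i < m" for i
    proof -
      have "(\<Sum>j<n. ?K $$ (n+i,j) * u j) = (\<Sum>j<n. - b i j * u j)"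
        using idx(3)[of 0 _ i 0] i assms(2) by (intro sum.cong) auto
      moreover have "(\<Sum>l<m. ?K $$ (n+i,n+l) * w l) = (\<Sum>l<m. a i l * w l)"
        using idx(4)[of 0 0 i] i assms(2) by (intro sum.cong) auto
      ultimately show ?thesis using Kv_sum[of "n+i"] i by (simp add: sum_negf)
    qed
  qed
  have res_mat: "(X * C * X - X * D - A * X + B) $$ (i,j) = res (\<lambda>i j. X $$ (i,j)) i j"
    if X: "X \<in> carrier_mat m n" and i: "i < m" and j: "j < n" for X i j
  proof -
    have "X * C * X = X * (C * X)" using X car by (intro assoc_mult_mat) auto
    then show ?thesis
      using X car i j
      by (simp add: res_def a_def b_def c_def d_def scalar_prod_def atLeast0LessThan)
  qed
  define P where "P = mat m n (\<lambda>(i,j). Phi i j)"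
  have P: "P \<in> carrier_mat m n" by (simp add: P_def)
  have P_idx: "P $$ (i,j) = Phi i j" if "i < m" "j < n" for i j using that by (simp add: P_def)
  have "res (\<lambda>i j. P $$ (i,j)) i j = res Phi i j" if "i < m" "j < n" for i j
    using that by (simp add: res_def P_idx)
  then have P_sol: "P * C * P - P * D - A * P + B = 0\<^sub>m m n"
    by (intro eq_matI) (use P car res_mat[OF P] res_Phi in \<open>auto simp del: index_add_mat(1)\<close>)
  have P_min: "P \<le> X"
    if X: "X \<in> carrier_mat m n" and X_nonneg: "nonneg_mat X"
      and X_sol: "X * C * X - X * D - A * X + B = 0\<^sub>m m n" for X
  proof -
    have "0 \<le> X $$ (i,j)" if "i < m" "j < n" for i j
      using X X_nonneg that by (auto simp: nonneg_mat_def less_eq_mat_def)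
    moreover have "res (\<lambda>i j. X $$ (i,j)) i j = 0" if "i < m" "j < n" for i j
      using res_mat[OF X that] X_sol that by simp
    ultimately have "Phi i j \<le> X $$ (i,j)" if "i < m" "j < n" for i j
      using Phi_le_solution[of i j "\<lambda>i j. X $$ (i,j)"] that by blast
    then show ?thesis using X P by (auto simp: less_eq_mat_def P_idx)
  qed
  have "nonneg_mat P" using P Phi_nonneg by (auto simp: nonneg_mat_def less_eq_mat_def P_idx)
  then have "minimal_nonneg_solution m n (\<lambda>X. X * C * X - X * D - A * X + B = 0\<^sub>m m n) P"
    using P P_sol P_min by (auto simp: minimal_nonneg_solution_def)
  moreover have "regular_M_matrix (D - C * P)"
  proof (rule regular_M_matrixI)
    show "D - C * P \<in> carrier_mat n n" using car P by (intro minus_carrier_mat) auto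
    have R_idx: "(D - C * P) $$ (k,j) = d k j - (\<Sum>l<m. c k l * Phi l j)"
      if "k < n" "j < n" for k j
      using that car P by (simp add: c_def d_def scalar_prod_def atLeast0LessThan P_idx)
    show "(D - C * P) $$ (k,j) \<le> 0" if "k < n" "j < n" "k \<noteq> j" for k j
    proof -
      have "0 \<le> (\<Sum>l<m. c k l * Phi l j)"
        using that c_nonneg Phi_nonneg by (intro sum_nonneg mult_nonneg_nonneg) auto
      then show ?thesis using R_idx d_off that by force
    qed
    show "vec n u \<in> carrier_vec n" by simp
    show "0 < vec n u $ j" if "j < n" for j using u_pos that by simp
    show "0 \<le> (\<Sum>j<n. (D - C * P) $$ (k,j) * vec n u $ j)" if k: "k < n" for k
    proof -
      have "(\<Sum>j<n. (D - C * P) $$ (k,j) * vec n u $ j)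
          = (\<Sum>j<n. d k j * u j - (\<Sum>l<m. c k l * Phi l j) * u j)"
        using k R_idx by (intro sum.cong) (auto simp: left_diff_distrib simp del: index_minus_mat(1))
      also have "\<dots> = (\<Sum>j<n. d k j * u j) - (\<Sum>l<m. c k l * (\<Sum>j<n. Phi l j * u j))"
        by (simp add: sum_subtractf sum_mult_assoc)
      finally have eq: "(\<Sum>j<n. (D - C * P) $$ (k,j) * vec n u $ j)
          = (\<Sum>j<n. d k j * u j) - (\<Sum>l<m. c k l * (\<Sum>j<n. Phi l j * u j))" .
      have "(\<Sum>l<m. c k l * (\<Sum>j<n. Phi l j * u j)) \<le> (\<Sum>l<m. c k l * w l)"
        using k c_nonneg Phi_mult_le by (intro sum_mono mult_left_mono) auto
      also have "\<dots> \<le> (\<Sum>j<n. d k j * u j)" by (rule top[OF k])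
      finally show ?thesis unfolding eq by simp
    qed
  qed (use assms(2) in simp)
  ultimately show ?thesis by blast
qed

end
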